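(* Let $d\ge 1$ and $\mu\ge 1$. The competitive ratio of Move To Front for the MinUsageTime Dynamic Vector Bin Packing problem in $d$ dimensions is at least $\max\{2\mu,(\mu+1)d\}$; i.e., for every $\delta>0$ there is an instance $\mathcal{R}$ whose ratio of maximum to minimum item duration is $\mu$ such that $\mathsf{cost}(\mathrm{MF},\mathcal{R}) \ge (\max\{2\mu,(\mu+1)d\}-\delta)\,\mathsf{OPT}(\mathcal{R})$.
   Context: MinUsageTime Dynamic Vector Bin Packing (non-clairvoyant, online, no repacking): an instance is a finite list $\mathcal{R}$ of items; each item $r$ has arrival time $a(r)\ge 0$, departure time $e(r)>a(r)$, and size $\mathbf{s}(r)\in[0,1]^d$. Its active interval is $I(r)=[a(r),e(r))$ with duration $e(r)-a(r)$. Bins have capacity $1$ in each of the $d$ coordinates. Items are revealed in order of arrival (ties in a given order); on arrival, an item must be irrevocably placed into a bin such that the total size of items currently active in that bin stays $\le 1$ in every coordinate; the departure time is unknown at arrival. A bin is open while it contains an active item; once all its items have departed it is closed and never used again. If bin $B_i$ receives item set $R_i$, the cost of algorithm $\mathcal{A}$ is $\mathsf{cost}(\mathcal{A},\mathcal{R})=\sum_i \mathrm{span}(R_i)$, where $\mathrm{span}(S)$ is the Lebesgue measure of $\bigcup_{r\in S} I(r)$. $\mathsf{OPT}(\mathcal{R})=\int \mathsf{OPT}(\mathcal{R},t)\,dt$, where $\mathsf{OPT}(\mathcal{R},t)$ is the minimum number of unit-capacity bins into which the items active at time $t$ can be packed (offline, repacking allowed). Move To Front: maintains the list of open bins ordered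 by most recent use; an arriving item is placed into the first bin in the list that can accommodate it, and if none can, a new bin is opened; the bin receiving the item is then moved to the front of the list. *)

theory Defs
  imports "HOL-Analysis.Analysis" "HOL-Library.Multiset"
begin

text \<open>
  The same item data may occur repeatedly, so instances and bins are lists of items rather than sets.
  The dimension is the cardinality of the index type \<open>'d\<close>.
\<close>

record ('d::finite) item =
  arrival :: real
  departure :: real
  demand :: "real ^ 'd"

definition duration :: "('d::finite) item \<Rightarrow> real" where
  "duration r = departure r - arrival r"

definition active_interval :: "('d::finite) item \<Rightarrow> real set" where
  "active_interval r = {arrival r..<departure r}"

text \<open>The list order is the order of revelation; in particular it resolves ties between
  simultaneous arrivals.\<close>

definition valid_instance :: "('d::finite) item list \<Rightarrow> bool" where
  "valid_instance R \<longleftrightarrow> sorted (map arrival R) \<and>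
     (\<forall>r\<in>set R. 0 \<le> arrival r \<and> arrival r < departure r \<and>
                (\<forall>i. 0 \<le> demand r $ i \<and> demand r $ i \<le> 1))"

definition duration_ratio :: "('d::finite) item list \<Rightarrow> real" where
  "duration_ratio R = Max (duration ` set R) / Min (duration ` set R)"

definition instances :: "real \<Rightarrow> ('d::finite) item list set" where
  "instances \<mu> = {R. R \<noteq> [] \<and> valid_instance R \<and> duration_ratio R = \<mu>}"

definition active_items :: "real \<Rightarrow> ('d::finite) item list \<Rightarrow> 'd item list" where
  "active_items t B = filter (\<lambda>r. t \<in> active_interval r) B"

definition within_capacity :: "('d::finite) item list \<Rightarrow> bool" where
  "within_capacity B \<longleftrightarrow> (\<forall>i. (\<Sum>r\<leftarrow>B. demand r $ i) \<le> 1)"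

definition item_span :: "('d::finite) item set \<Rightarrow> real" where
  "item_span S = measure lborel (\<Union>r\<in>S. active_interval r)"

text \<open>An algorithm is represented by the list of all bins it produces on an instance, each
  bin being the list of all items it ever receives.\<close>

type_synonym 'd algorithm = "'d item list \<Rightarrow> 'd item list list"

definition cost :: "('d::finite) algorithm \<Rightarrow> 'd item list \<Rightarrow> real" where
  "cost A R = (\<Sum>B\<leftarrow>A R. item_span (set B))"

definition OPT_at :: "('d::finite) item list \<Rightarrow> real \<Rightarrow> nat" where
  "OPT_at R t = (LEAST k. \<exists>Bs. length Bs = k \<and>
     mset (concat Bs) = mset (active_items t R) \<and> (\<forall>B\<in>set Bs. within_capacity B))"

definition OPT :: "('d::finite) item list \<Rightarrow> real" where
  "OPT R = (\<integral>t. real (OPT_at R t) \<partial>lborel)"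

definition is_open :: "real \<Rightarrow> ('d::finite) item list \<Rightarrow> bool" where
  "is_open t B \<longleftrightarrow> active_items t B \<noteq> []"

definition can_accommodate :: "('d::finite) item \<Rightarrow> 'd item list \<Rightarrow> bool" where
  "can_accommodate r B \<longleftrightarrow> within_capacity (r # active_items (arrival r) B)"

text \<open>The state is the list of all bins opened so far, the most recently used one first.
  Closed bins are kept in the list (their cost still counts) but are never selected, so
  the choice is made from the sublist of open bins. The function \<open>List.extract P xs\<close> splits
  \<open>xs\<close> at the first element satisfying \<open>P\<close>.\<close>

definition mf_step :: "('d::finite) item \<Rightarrow> 'd item list list \<Rightarrow> 'd item list list" where
  "mf_step r bins =
     (case List.extract (\<lambda>B. is_open (arrival r) B \<and> can_accommodate r B) bins of
        None \<Rightarrow> [r] # bins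
      | Some (xs, B, ys) \<Rightarrow> (r # B) # xs @ ys)"

definition move_to_front :: "('d::finite) algorithm" where
  "move_to_front R = fold mf_step R []"

text \<open>All items have positive duration, and an active item needs a bin even if its size is
  the zero vector, so \<open>OPT R > 0\<close> for every \<open>R \<in> instances \<mu>\<close>.\<close>

definition competitive_ratio :: "('d::finite) algorithm \<Rightarrow> real \<Rightarrow> ereal" where
  "competitive_ratio A \<mu> = (SUP R\<in>instances \<mu>. ereal (cost A R / OPT R))"

end

theory Submission
  imports Defs "HOL-Real_Asymp.Real_Asymp"
begin

text \<open>
  Both instances force Move To Front into many bins, each kept alive by a single tiny long item,
  whereas all the tiny items together fit into one bin.

  For \<open>2 * \<mu>\<close>, short items of size \<open>1/2\<close> alternate with long tiny ones. Each tiny item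
  follows its predecessor into the front bin, after which no further half fits there.
  An offline packing pairs the halves.

  For \<open>(\<mu> + 1) * d\<close>, the short items are almost full in one coordinate and nearly zero in the
  others, so that offline \<open>d\<close> of them share a bin; alternating fillers again block all sharing.
  The fillers leave a gap just sufficient for one more tiny item per bin, and these long items
  arrive shortly before the short ones depart, so every bin lives for almost \<open>1 + \<mu>\<close>.
\<close>

section \<open>Offline packings\<close>

text \<open>Only finitely many lists occur as \<open>t\<close> varies, each on a Borel set. The
  functional \<open>g\<close> is arbitrary so that the induction can absorb the head item into
  it.\<close>

lemma borel_measurable_active_items:
  fixes g :: "('d::finite) item list \<Rightarrow> real"
  shows "(\<lambda>t. g (active_items t R)) \<in> borel_measurable borel"
proof (induction R arbitrary: g)
  case Nil
  then show ?case by (simp add: active_items_def)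
next
  case (Cons r R)
  have *: "(\<lambda>t. g (active_items t (r # R))) =
      (\<lambda>t. if t \<in> active_interval r then g (r # active_items t R) else g (active_items t R))"
    by (auto simp: active_items_def)
  have "active_interval r \<in> sets borel" by (simp add: active_interval_def)
  then show ?case
    unfolding * using Cons.IH[of "\<lambda>L. g (r # L)"] Cons.IH[of g]
    by (intro measurable_If) auto
qed

lemma borel_measurable_OPT_at: "(\<lambda>t. real (OPT_at R t)) \<in> borel_measurable lborel"
  using borel_measurable_active_items[where g = "\<lambda>L. real (LEAST k. \<exists>Bs. length Bs = k \<and>
     mset (concat Bs) = mset L \<and> (\<forall>B\<in>set Bs. within_capacity B))" and R = R]
  by (simp add: OPT_at_def)

lemma OPT_at_le:
  assumes "mset (concat Bs) = mset (active_items t R)" "\<forall>B\<in>set Bs. within_capacity B"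
  shows "OPT_at R t \<le> length Bs"
  unfolding OPT_at_def by (rule Least_le) (use assms in blast)

text \<open>A packing that could hold all items at once stays feasible at every time: discarding
  inactive items only lowers nonnegative loads, and bins left empty are dropped.\<close>

lemma OPT_at_le_open_bins:
  assumes nonneg: "\<And>r i. r \<in> set R \<Longrightarrow> 0 \<le> demand r $ i"
    and packs: "mset (concat Bs) = mset R"
    and cap: "\<And>B. B \<in> set Bs \<Longrightarrow> within_capacity B"
  shows "OPT_at R t \<le> length (filter (is_open t) Bs)"
proof -
  let ?Cs = "map (active_items t) (filter (is_open t) Bs)"
  have "concat ?Cs = active_items t (concat Bs)"
    by (induction Bs) (auto simp: active_items_def is_open_def)
  then have "mset (concat ?Cs) = mset (active_items t R)"
    using packs by (simp add: active_items_def)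
  moreover have "within_capacity C" if "C \<in> set ?Cs" for C
  proof -
    from that obtain B where B: "B \<in> set Bs" "C = active_items t B" by auto
    have sub: "set B \<subseteq> set R" using B(1) mset_eq_setD[OF packs] by auto
    have "(\<Sum>r\<leftarrow>C. demand r $ i) \<le> (\<Sum>r\<leftarrow>B. demand r $ i)" for i
      using sub unfolding B(2) active_items_def
      by (induction B) (auto intro: nonneg add_increasing)
    moreover have "(\<Sum>r\<leftarrow>B. demand r $ i) \<le> 1" for i
      using cap[OF B(1)] by (simp add: within_capacity_def)
    ultimately show ?thesis
      unfolding within_capacity_def by (meson order_trans)
  qed
  ultimately show ?thesis
    using OPT_at_le[of ?Cs t R] by simp
qed

section \<open>Integrating the number of open bins\<close>

lemma is_open_iff: "is_open t B \<longleftrightarrow> t \<in> (\<Union>r\<in>set B. active_interval r)"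
  by (auto simp: is_open_def active_items_def filter_empty_conv)

lemma active_interval_fmeasurable: "active_interval r \<in> fmeasurable lborel"
  by (cases "arrival r \<le> departure r") (auto simp: active_interval_def intro!: fmeasurableI)

lemma active_union_fmeasurable:
  "(\<Union>r\<in>set B. active_interval r) \<in> fmeasurable lborel"
  by (intro fmeasurable.finite_UN active_interval_fmeasurable) simp

text \<open>A bin is open exactly on the union of its active intervals, so the count of open bins is
  a sum of indicators, each integrating to the span of its bin.\<close>

lemma open_bins_has_integral:
  "integrable lborel (\<lambda>t. real (length (filter (is_open t) Bs)))"
  "(\<integral>t. real (length (filter (is_open t) Bs)) \<partial>lborel) = (\<Sum>B\<leftarrow>Bs. item_span (set B))"
proof -
  let ?U = "\<lambda>B. (\<Union>r\<in>set B. active_interval r)"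
  have eq: "real (length (filter (is_open t) (B # Bs))) =
      indicator (?U B) t + real (length (filter (is_open t) Bs))" for t B Bs
    by (simp add: is_open_iff indicator_def)
  have int: "integrable lborel (indicator (?U B) :: real \<Rightarrow> real)" for B
    using active_union_fmeasurable[of B]
    by (intro integrable_real_indicator) (auto simp: fmeasurable_def)
  have I: "integrable lborel (\<lambda>t. real (length (filter (is_open t) Bs)))" for Bs
    by (induction Bs) (auto simp only: eq intro!: Bochner_Integration.integrable_add int, simp)
  show "integrable lborel (\<lambda>t. real (length (filter (is_open t) Bs)))" by (rule I)
  show "(\<integral>t. real (length (filter (is_open t) Bs)) \<partial>lborel) = (\<Sum>B\<leftarrow>Bs. item_span (set B))"
  proof (induction Bs)
    case (Cons B Bs)
    have "(\<integral>t. indicator (?U B) t + real (length (filter (is_open t) Bs)) \<partial>lborel) =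
        item_span (set B) + (\<Sum>B\<leftarrow>Bs. item_span (set B))"
      using Bochner_Integration.integral_add[OF int[of B] I[of Bs]] Cons.IH
      by (simp add: item_span_def)
    then show ?case by (simp only: eq list.map sum_list.Cons)
  qed simp
qed

lemma integrable_OPT_at:
  assumes "valid_instance R"
  shows "integrable lborel (\<lambda>t. real (OPT_at R t))"
proof (rule Bochner_Integration.integrable_bound)
  \<comment> \<open>One bin per item is a feasible packing and yields an integrable
    majorant.\<close>
  let ?Bs = "map (\<lambda>r. [r]) R"
  show "integrable lborel (\<lambda>t. real (length (filter (is_open t) ?Bs)))"
    by (rule open_bins_has_integral)
  have "OPT_at R t \<le> length (filter (is_open t) ?Bs)" for t
    using assms by (intro OPT_at_le_open_bins) (auto simp: valid_instance_def within_capacity_def)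
  then show "AE t in lborel. norm (real (OPT_at R t)) \<le>
      norm (real (length (filter (is_open t) ?Bs)))" by simp
qed (rule borel_measurable_OPT_at)

text \<open>Integrates the pointwise bound by open bins. Both constructions bound the optimum
  through this, so no repacking over time has to be described.\<close>

lemma OPT_le_static_packing:
  assumes "valid_instance R" "mset (concat Bs) = mset R"
    and "\<And>B. B \<in> set Bs \<Longrightarrow> within_capacity B"
  shows "OPT R \<le> (\<Sum>B\<leftarrow>Bs. item_span (set B))"
proof -
  have "OPT_at R t \<le> length (filter (is_open t) Bs)" for t
    using assms by (intro OPT_at_le_open_bins) (auto simp: valid_instance_def)
  then show ?thesis
    unfolding OPT_def open_bins_has_integral(2)[symmetric]
    by (intro integral_mono integrable_OPT_at open_bins_has_integral(1) assms) simp
qed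

lemma OPT_at_pos:
  assumes "valid_instance R" "r \<in> set R" "t \<in> active_interval r"
  shows "1 \<le> OPT_at R t"
proof -
  let ?P = "\<lambda>k. \<exists>Bs. length Bs = k \<and>
     mset (concat Bs) = mset (active_items t R) \<and> (\<forall>B\<in>set Bs. within_capacity B)"
  \<comment> \<open>Some packing must exist for the \<open>LEAST\<close> to be attained; singleton
    bins qualify because each demand is at most 1.\<close>
  let ?Bs = "map (\<lambda>r. [r]) (active_items t R)"
  have "?P (length ?Bs)"
    using assms(1)
    by (intro exI[of _ ?Bs]) (auto simp: valid_instance_def within_capacity_def active_items_def)
  then have P: "?P (OPT_at R t)"
    unfolding OPT_at_def by (rule LeastI)
  have "active_items t R \<noteq> []"
    using assms by (auto simp: active_items_def filter_empty_conv)
  then have "\<not> ?P 0" by auto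
  with P show ?thesis by (metis less_one not_less)
qed

lemma OPT_pos:
  assumes "valid_instance R" "R \<noteq> []"
  shows "0 < OPT R"
proof -
  let ?r = "hd R"
  have r: "?r \<in> set R" using assms by simp
  then have lt: "arrival ?r < departure ?r" using assms by (auto simp: valid_instance_def)
  have "departure ?r - arrival ?r = (\<integral>t. indicator (active_interval ?r) t \<partial>lborel)"
    using lt by (simp add: active_interval_def)
  also have "\<dots> \<le> OPT R"
    unfolding OPT_def
  proof (rule integral_mono)
    show "integrable lborel (indicator (active_interval ?r) :: real \<Rightarrow> real)"
      using active_interval_fmeasurable[of ?r]
      by (intro integrable_real_indicator) (auto simp: fmeasurable_def)
    show "indicator (active_interval ?r) t \<le> real (OPT_at R t)" for t
      using OPT_at_pos[OF assms(1) r] by (auto simp: indicator_def)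
  qed (rule integrable_OPT_at[OF assms(1)])
  finally show ?thesis using lt by simp
qed

section \<open>From families of instances to the competitive ratio\<close>

lemma competitive_ratio_geI:
  fixes A :: "('d::finite) algorithm"
  assumes "\<And>\<delta>. \<delta> > 0 \<Longrightarrow> \<exists>R\<in>instances \<mu>. cost A R \<ge> (c - \<delta>) * OPT R"
  shows "competitive_ratio A \<mu> \<ge> ereal c"
proof (rule ereal_le_epsilon2)
  fix \<delta> :: real
  assume "0 < \<delta>"
  then obtain R where R: "R \<in> instances \<mu>" "cost A R \<ge> (c - \<delta>) * OPT R"
    using assms by blast
  then have "0 < OPT R" by (intro OPT_pos) (auto simp: instances_def)
  with R have "c - \<delta> \<le> cost A R / OPT R" by (simp add: field_simps)
  then have "ereal (c - \<delta>) \<le> ereal (cost A R / OPT R)" by simp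
  also have "\<dots> \<le> competitive_ratio A \<mu>"
    unfolding competitive_ratio_def by (rule SUP_upper[OF R(1)])
  finally have "ereal (c - \<delta>) + ereal \<delta> \<le> competitive_ratio A \<mu> + ereal \<delta>"
    by (rule add_right_mono)
  then show "ereal c \<le> competitive_ratio A \<mu> + ereal \<delta>" by simp
qed

text \<open>Each construction approaches its bound only as the parameter \<open>n\<close> grows.
  Positivity of \<open>OPT R\<close> allows \<open>q n\<close> to be replaced by the smaller factor
  \<open>c - \<delta>\<close>.\<close>

lemma near_limit_instance:
  fixes A :: "('d::finite) algorithm"
  assumes "q \<longlonglongrightarrow> c" "\<delta> > 0"
    and "\<And>n. n \<ge> 1 \<Longrightarrow> \<exists>R\<in>instances \<mu>. cost A R \<ge> q n * OPT R"
  shows "\<exists>R\<in>instances \<mu>. cost A R \<ge> (c - \<delta>) * OPT R"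
proof -
  have "\<forall>\<^sub>F n in sequentially. c - \<delta> < q n"
    using assms(1,2) by (intro order_tendstoD(1)) auto
  then have "\<forall>\<^sub>F n in sequentially. c - \<delta> < q n \<and> n \<ge> 1"
    using eventually_ge_at_top[of 1] by eventually_elim auto
  then obtain n where n: "c - \<delta> < q n" "n \<ge> 1"
    by (auto dest: eventually_happens)
  then obtain R where R: "R \<in> instances \<mu>" "cost A R \<ge> q n * OPT R"
    using assms(3) by blast
  then have "0 < OPT R" by (intro OPT_pos) (auto simp: instances_def)
  then have "(c - \<delta>) * OPT R \<le> q n * OPT R"
    using n by (intro mult_right_mono) auto
  with R show ?thesis by (intro bexI[of _ R]) auto
qed

section \<open>Runs of Move To Front\<close>

lemma mf_step_new:
  assumes "\<And>B. B \<in> set Bs \<Longrightarrow> \<not> can_accommodate r B"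
  shows "mf_step r Bs = [r] # Bs"
proof -
  have "List.extract (\<lambda>B. is_open (arrival r) B \<and> can_accommodate r B) Bs = None"
    using assms by (auto simp: extract_None_iff)
  then show ?thesis by (simp add: mf_step_def)
qed

lemma mf_step_first:
  assumes "\<And>C. C \<in> set Cs \<Longrightarrow> \<not> can_accommodate r C"
    and "is_open (arrival r) B" "can_accommodate r B"
  shows "mf_step r (Cs @ B # Bs) = (r # B) # Cs @ Bs"
proof -
  have "List.extract (\<lambda>B. is_open (arrival r) B \<and> can_accommodate r B) (Cs @ B # Bs) =
      Some (Cs, B, Bs)"
    using assms by (auto simp: extract_Some_iff)
  then show ?thesis by (simp add: mf_step_def)
qed

text \<open>Invariant: every bin present is a pair \<open>[f, b]\<close>. All of them reject the
  next \<open>b'\<close>, which opens a bin at the front, and the following \<open>f\<close> fits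
  there. The reversal records that later bins stand further in front.\<close>

lemma fold_mf_step_alternating:
  assumes "\<And>b. b \<in> set bs \<Longrightarrow> is_open (arrival f) [b] \<and> can_accommodate f [b]"
    and "\<And>b b'. b \<in> set bs \<Longrightarrow> b' \<in> set bs \<Longrightarrow> \<not> can_accommodate b' [f, b]"
  shows "fold mf_step (concat (map (\<lambda>b. [b, f]) bs)) [] = rev (map (\<lambda>b. [f, b]) bs)"
  using assms
proof (induction bs rule: rev_induct)
  case (snoc b bs)
  have "mf_step b (rev (map (\<lambda>b. [f, b]) bs)) = [b] # rev (map (\<lambda>b. [f, b]) bs)"
    using snoc.prems(2) by (intro mf_step_new) auto
  moreover have "mf_step f ([b] # rev (map (\<lambda>b. [f, b]) bs)) = [f, b] # rev (map (\<lambda>b. [f, b]) bs)"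
    using mf_step_first[of "[]" f "[b]" "rev (map (\<lambda>b. [f, b]) bs)"] snoc.prems(1) by auto
  ultimately show ?case using snoc by simp
qed simp

text \<open>\<open>Cs\<close> collects the bins that are full for \<open>l\<close>. A bin that
  receives \<open>l\<close> moves to the front and becomes one of them, so the next copy passes over
  all of \<open>Cs\<close> and reaches the first untouched bin.\<close>

lemma fold_mf_step_replicate:
  assumes "\<And>B. B \<in> set Bs \<Longrightarrow> is_open (arrival l) B \<and> can_accommodate l B \<and>
      \<not> can_accommodate l (l # B)"
    and "\<And>C. C \<in> set Cs \<Longrightarrow> \<not> can_accommodate l C"
  shows "fold mf_step (replicate (length Bs) l) (Cs @ Bs) = rev (map ((#) l) Bs) @ Cs"
  using assms
proof (induction Bs arbitrary: Cs)
  case (Cons B Bs)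
  have "mf_step l (Cs @ B # Bs) = ((l # B) # Cs) @ Bs"
    using Cons.prems by (subst mf_step_first) auto
  moreover have "fold mf_step (replicate (length Bs) l) (((l # B) # Cs) @ Bs) =
      rev (map ((#) l) Bs) @ (l # B) # Cs"
    using Cons.prems by (intro Cons.IH) auto
  ultimately show ?case by simp
qed simp

section \<open>Item lists, spans and duration ratios\<close>

lemma mset_alternating:
  "mset (concat (map (\<lambda>b. [b, f]) bs)) = mset bs + replicate_mset (length bs) f"
  by (induction bs) auto

lemma set_alternating:
  "bs \<noteq> [] \<Longrightarrow> set (concat (map (\<lambda>b. [b, f]) bs)) = insert f (set bs)"
  by (cases bs) auto

lemma within_capacity_replicate:
  assumes "\<And>i. real n * demand r $ i \<le> 1"
  shows "within_capacity (replicate n r)"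
  using assms by (simp add: within_capacity_def sum_list_replicate)

lemma duration_ratio_eq:
  assumes "0 < x" "x \<le> y" "duration ` set R = {x, y}"
  shows "duration_ratio R = y / x"
  using assms by (simp add: duration_ratio_def)

lemma item_span_Ico:
  assumes "(\<Union>r\<in>S. active_interval r) = {a..<b}" "a \<le> b"
  shows "item_span S = b - a"
  using assms by (simp add: item_span_def)

definition uniform_item :: "real \<Rightarrow> real \<Rightarrow> real \<Rightarrow> ('d::finite) item" where
  "uniform_item a e s = \<lparr>arrival = a, departure = e, demand = (\<chi> i. s)\<rparr>"

lemma uniform_item_simps [simp]:
  "arrival (uniform_item a e s) = a"
  "departure (uniform_item a e s) = e"
  "demand (uniform_item a e s) $ i = s"
  by (simp_all add: uniform_item_def)

lemmas mf_simps = is_open_def can_accommodate_def within_capacity_def active_items_def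
  active_interval_def

section \<open>The two lower bounds\<close>

text \<open>Move To Front opens \<open>2 * n\<close> bins of span \<open>\<mu>\<close>, while the
  offline packing costs \<open>n + \<mu>\<close>.\<close>

lemma mf_lower_bound_halves:
  fixes \<mu> :: real
  assumes \<mu>: "\<mu> \<ge> 1" and n: "n \<ge> 1"
  shows "\<exists>R\<in>instances \<mu>. cost (move_to_front :: ('d::finite) algorithm) R \<ge>
    (2 * real n * \<mu> / (real n + \<mu>)) * OPT R"
proof -
  define h :: "'d item" where "h = uniform_item 0 1 (1/2)"
  \<comment> \<open>Small enough for all \<open>2 * n\<close> tiny items to share one bin, yet
    positive, so that a bin with a half and a tiny item rejects a second half.\<close>
  define s where "s = 1 / (2 * real n)"
  have s: "0 < s" "s \<le> 1 / 2" "real (2 * n) * s \<le> 1" using n by (auto simp: s_def field_simps)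
  define f :: "'d item" where "f = uniform_item 0 \<mu> s"
  define bs where "bs = replicate (2 * n) h"
  define R where "R = concat (map (\<lambda>b. [b, f]) bs)"
  have bs: "bs \<noteq> []" "set bs = {h}" "length bs = 2 * n" using n by (auto simp: bs_def)
  have setR: "set R = {f, h}"
    unfolding R_def using set_alternating[of bs f] bs by simp
  have valid: "valid_instance R"
  proof -
    have "map arrival R = replicate (length R) 0"
      using setR by (intro replicate_eqI[symmetric] replicate_eqI) (auto simp: h_def f_def)
    then have "sorted (map arrival R)" by (metis sorted_replicate)
    then show ?thesis
      using setR \<mu> s by (auto simp: valid_instance_def h_def f_def)
  qed
  have "duration ` set R = {1, \<mu>}"
    unfolding setR by (auto simp: duration_def h_def f_def)
  then have "duration_ratio R = \<mu>"
    using duration_ratio_eq[of 1 \<mu> R] \<mu> by simp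
  moreover have "R \<noteq> []" using setR by auto
  ultimately have inst: "R \<in> instances \<mu>" using valid by (simp add: instances_def)
  have mf: "move_to_front R = rev (map (\<lambda>b. [f, b]) bs)"
    unfolding move_to_front_def R_def
  proof (rule fold_mf_step_alternating, goal_cases)
    case (1 b)
    then show ?case using bs \<mu> s by (auto simp: mf_simps h_def f_def)
  next
    case (2 b b')
    then show ?case using bs \<mu> s by (auto simp: mf_simps h_def f_def)
  qed
  have "(\<Union>r\<in>{f, h}. active_interval r) = {0..<\<mu>}"
    using \<mu> by (auto simp: active_interval_def h_def f_def)
  from item_span_Ico[OF this] have "item_span {f, h} = \<mu>" using \<mu> by simp
  then have cost: "cost move_to_front R = 2 * real n * \<mu>"
    unfolding cost_def mf using bs
    by (simp add: bs_def sum_list_replicate rev_map[symmetric])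
  \<comment> \<open>The \<open>n\<close> pairs of halves have span 1 each; the bin with all tiny
    items has span \<open>\<mu>\<close>.\<close>
  have "OPT R \<le> (\<Sum>B\<leftarrow>replicate n [h, h] @ [replicate (2 * n) f]. item_span (set B))"
  proof (rule OPT_le_static_packing[OF valid])
    have "mset (concat (replicate n [h, h])) = replicate_mset (2 * n) h"
      by (induction n) auto
    then show "mset (concat (replicate n [h, h] @ [replicate (2 * n) f])) = mset R"
      by (simp only: R_def mset_alternating) (simp add: bs_def)
  next
    fix B assume "B \<in> set (replicate n [h, h] @ [replicate (2 * n) f])"
    then consider "B = [h, h]" | "B = replicate (2 * n) f" by auto
    then show "within_capacity B"
      using s by cases (auto simp: within_capacity_def h_def f_def sum_list_replicate)
  qed
  also have "\<dots> = real n + \<mu>"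
  proof -
    have "item_span {h} = 1" "item_span {f} = \<mu>"
      using item_span_Ico[of "{h}" 0 1] item_span_Ico[of "{f}" 0 \<mu>] \<mu>
      by (auto simp: active_interval_def h_def f_def)
    then show ?thesis using n by (simp add: sum_list_replicate)
  qed
  finally have "(2 * real n * \<mu> / (real n + \<mu>)) * OPT R \<le>
      (2 * real n * \<mu> / (real n + \<mu>)) * (real n + \<mu>)"
    using \<mu> by (intro mult_left_mono) auto
  also have "\<dots> = cost move_to_front R" using cost \<mu> by simp
  finally show ?thesis using inst by blast
qed

text \<open>Move To Front keeps \<open>n * CARD('d)\<close> bins alive for
  \<open>1 - \<tau> + \<mu>\<close> each. Offline, \<open>n\<close> bins of span 1 hold the large
  items, one of span 1 the fillers, and one of span \<open>\<mu>\<close> the long items.\<close>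

lemma mf_lower_bound_dimension:
  fixes \<mu> :: real
  assumes \<mu>: "\<mu> \<ge> 1" and n: "n \<ge> 1"
  shows "\<exists>R\<in>instances \<mu>. cost (move_to_front :: ('d::finite) algorithm) R \<ge>
    (real n * real CARD('d) * (1 - 1 / (real n + 1) + \<mu>) / (real n + 1 + \<mu>)) * OPT R"
proof -
  define d where "d = CARD('d)"
  define N where "N = n * d"
  have d: "d \<ge> 1" unfolding d_def by (simp add: Suc_leI)
  have N: "N \<ge> 1" using n d by (simp add: N_def)
  define z where "z = 1 / (8 * real d * real N)"
  \<comment> \<open>The long items arrive \<open>\<tau>\<close> before the short ones depart. This
    lead is positive, so all bins are still open, and it vanishes as \<open>n\<close> grows.\<close>
  define \<tau> where "\<tau> = 1 / (real n + 1)"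
  have \<tau>: "0 < \<tau>" "\<tau> < 1" using n by (auto simp: \<tau>_def)
  have z0: "0 < z" using d N by (simp add: z_def)
  define w where "w = real d * z"
  have wN: "real N * (2 * w) \<le> 1" using d N by (simp add: w_def z_def)
  have w: "z \<le> w" "8 * w \<le> 1"
    using d N z0 by (simp_all add: w_def z_def field_simps)
  \<comment> \<open>With a filler of size \<open>2 * w\<close>, the load in coordinate
    \<open>j\<close> becomes \<open>1 - z\<close>. The gap \<open>z\<close> admits exactly one long
    item but no demand of \<open>2 * z\<close>, the smallest demand of a large item.\<close>
  define big :: "'d \<Rightarrow> 'd item" where
    "big j = \<lparr>arrival = 0, departure = 1,
       demand = (\<chi> i. if i = j then 1 - (2 * w + z) else 2 * z)\<rparr>" for j
  define f :: "'d item" where "f = uniform_item 0 1 (2 * w)"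
  define l :: "'d item" where "l = uniform_item (1 - \<tau>) (1 - \<tau> + \<mu>) z"
  have big_simps: "arrival (big j) = 0" "departure (big j) = 1"
    "demand (big j) $ i = (if i = j then 1 - (2 * w + z) else 2 * z)" for i j
    by (simp_all add: big_def)
  note item_simps = big_simps f_def l_def
  obtain js :: "'d list" where js: "set js = UNIV" "distinct js"
    using finite_distinct_list[of "UNIV :: 'd set"] by auto
  then have len_js: "length js = d" using distinct_card[of js] by (simp add: d_def)
  \<comment> \<open>Each of the \<open>n\<close> rounds has one large item per coordinate and forms
    one bin of the offline packing.\<close>
  define bs where "bs = concat (replicate n (map big js))"
  have bs: "set bs = range big" "length bs = N" "bs \<noteq> []"
  proof -
    show "set bs = range big" using n js by (auto simp: bs_def)
    then show "bs \<noteq> []" by auto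
    show "length bs = N" by (simp add: bs_def length_concat sum_list_replicate len_js N_def)
  qed
  define S where "S = concat (map (\<lambda>b. [b, f]) bs)"
  define R where "R = S @ replicate N l"
  have setS: "set S = insert f (range big)"
    unfolding S_def using set_alternating[of bs f] bs by simp
  have setR: "set R = {f, l} \<union> range big"
    unfolding R_def using setS N by auto
  have valid: "valid_instance R"
  proof -
    have "map arrival S = replicate (length S) 0"
      using setS by (intro replicate_eqI[symmetric] replicate_eqI) (auto simp: item_simps)
    then have "sorted (map arrival R)"
      using \<tau> setS by (auto simp: R_def sorted_append item_simps)
    then show ?thesis
      using setR \<mu> \<tau> z0 w by (auto simp: valid_instance_def item_simps)
  qed
  have "duration ` set R = {1, \<mu>}"
    unfolding setR by (auto simp: duration_def item_simps image_Un)
  then have "duration_ratio R = \<mu>"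
    using duration_ratio_eq[of 1 \<mu> R] \<mu> by simp
  moreover have "R \<noteq> []" using setR by auto
  ultimately have inst: "R \<in> instances \<mu>" using valid by (simp add: instances_def)
  have mfS: "fold mf_step S [] = rev (map (\<lambda>b. [f, b]) bs)"
    unfolding S_def
  proof (rule fold_mf_step_alternating, goal_cases)
    case (1 b)
    then show ?case using bs z0 w by (auto simp: mf_simps item_simps)
  next
    case (2 b b')
    then obtain j j' where j: "b = big j" "b' = big j'" using bs by auto
    \<comment> \<open>The obstruction lies in the heavy coordinate \<open>j\<close> of the resident
      item \<open>b\<close>, whichever coordinate is heavy for \<open>b'\<close>.\<close>
    have "\<not> (\<Sum>r\<leftarrow>[b', f, b]. demand r $ j) \<le> 1"
      using z0 w by (auto simp: j item_simps)
    then show ?case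
      using \<tau> by (auto simp: can_accommodate_def within_capacity_def active_items_def
        active_interval_def j item_simps)
  qed
  have mf: "move_to_front R = map (\<lambda>b. [l, f, b]) bs"
  proof -
    let ?Bs = "rev (map (\<lambda>b. [f, b]) bs)"
    have "fold mf_step (replicate (length ?Bs) l) ([] @ ?Bs) = rev (map ((#) l) ?Bs) @ []"
    proof (rule fold_mf_step_replicate, goal_cases)
      case (1 B)
      then obtain j where j: "B = [f, big j]" using bs by auto
      \<comment> \<open>The first long item fills coordinate \<open>j\<close> exactly to 1, so a
        second one overflows it.\<close>
      have "\<not> (\<Sum>r\<leftarrow>[l, l, f, big j]. demand r $ j) \<le> 1"
        using z0 w by (auto simp: item_simps)
      then have "\<not> can_accommodate l (l # B)"
        using \<tau> \<mu> by (auto simp: can_accommodate_def within_capacity_def active_items_def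
          active_interval_def j item_simps)
      moreover have "is_open (arrival l) B \<and> can_accommodate l B"
        using z0 w \<tau> by (auto simp: mf_simps j item_simps)
      ultimately show ?case by blast
    qed simp
    then show ?thesis
      by (simp add: move_to_front_def R_def mfS bs rev_map o_def)
  qed
  have "item_span (set [l, f, b]) = 1 - \<tau> + \<mu>" if "b \<in> set bs" for b
  proof -
    have "(\<Union>r\<in>set [l, f, b]. active_interval r) = {0..<1 - \<tau> + \<mu>}"
      using that bs \<tau> \<mu> by (auto simp: active_interval_def item_simps)
    from item_span_Ico[OF this] show ?thesis using \<tau> \<mu> by simp
  qed
  then have "map (\<lambda>B. item_span (set B)) (move_to_front R) = map (\<lambda>_. 1 - \<tau> + \<mu>) bs"
    by (simp add: mf)
  then have cost: "cost move_to_front R = real N * (1 - \<tau> + \<mu>)"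
    by (simp add: cost_def bs sum_list_triv)
  let ?Bs = "replicate n (map big js) @ [replicate N f, replicate N l]"
  have "OPT R \<le> (\<Sum>B\<leftarrow>?Bs. item_span (set B))"
  proof (rule OPT_le_static_packing[OF valid])
    show "mset (concat ?Bs) = mset R"
      by (simp add: R_def S_def mset_alternating bs flip: bs_def)
  next
    fix B assume "B \<in> set ?Bs"
    then consider "B = map big js" | "B = replicate N f" | "B = replicate N l" by auto
    then show "within_capacity B"
    proof cases
      case 1
      have "(\<Sum>r\<leftarrow>B. demand r $ i) \<le> 1" for i
      proof -
        have "(\<Sum>r\<leftarrow>B. demand r $ i) = (\<Sum>j\<in>UNIV. demand (big j) $ i)"
          using js by (simp add: 1 o_def sum_list_distinct_conv_sum_set)
        also have "\<dots> = demand (big i) $ i + (\<Sum>j\<in>UNIV - {i}. demand (big j) $ i)"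
          by (simp add: sum.remove)
        also have "(\<Sum>j\<in>UNIV - {i}. demand (big j) $ i) = (\<Sum>j\<in>UNIV - {i}. 2 * z)"
          by (intro sum.cong) (auto simp: item_simps)
        also have "\<dots> = (real d - 1) * (2 * z)"
          using d by (simp add: d_def card_Diff_singleton of_nat_diff)
        \<comment> \<open>Since \<open>w = real d * z\<close>, the reserve \<open>2 * w\<close> left
          by the heavy item covers the \<open>d - 1\<close> demands of \<open>2 * z\<close>; the
          total is \<open>1 - 3 * z\<close>.\<close>
        also have "demand (big i) $ i + (real d - 1) * (2 * z) \<le> 1"
          using z0 by (simp add: item_simps w_def algebra_simps)
        finally show ?thesis .
      qed
      then show ?thesis by (simp add: within_capacity_def)
    next
      case 2
      then show ?thesis
        using wN by (auto intro!: within_capacity_replicate simp: item_simps)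
    next
      case 3
      have "real N * z \<le> real N * (2 * w)"
        using w z0 by (intro mult_left_mono) auto
      then show ?thesis
        using 3 wN by (auto intro!: within_capacity_replicate simp: item_simps)
    qed
  qed
  also have "\<dots> = real n + 1 + \<mu>"
  proof -
    have "item_span (range big) = 1" "item_span {f} = 1" "item_span {l} = \<mu>"
      using item_span_Ico[of "range big" 0 1] item_span_Ico[of "{f}" 0 1]
        item_span_Ico[of "{l}" "1 - \<tau>" "1 - \<tau> + \<mu>"] \<mu>
      by (auto simp: active_interval_def item_simps)
    then show ?thesis using n N js by (simp add: sum_list_replicate)
  qed
  finally have opt: "OPT R \<le> real n + 1 + \<mu>" .
  have "(real N * (1 - \<tau> + \<mu>) / (real n + 1 + \<mu>)) * OPT R \<le>
      (real N * (1 - \<tau> + \<mu>) / (real n + 1 + \<mu>)) * (real n + 1 + \<mu>)"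
    using \<mu> \<tau> opt by (intro mult_left_mono) auto
  also have "\<dots> = cost move_to_front R" using cost \<mu> by simp
  finally show ?thesis using inst by (auto simp: N_def d_def \<tau>_def)
qed

theorem theorem7:
  fixes \<mu> :: real
  assumes "\<mu> \<ge> 1"
  shows "competitive_ratio (move_to_front :: ('d::finite) algorithm) \<mu>
           \<ge> ereal (max (2 * \<mu>) ((\<mu> + 1) * real CARD('d)))
       \<and> (\<forall>\<delta>>0. \<exists>R :: 'd item list. R \<in> instances \<mu> \<and>
            cost move_to_front R \<ge> (max (2 * \<mu>) ((\<mu> + 1) * real CARD('d)) - \<delta>) * OPT R)"
proof -
  have "(\<lambda>n. 2 * real n * \<mu> / (real n + \<mu>)) \<longlonglongrightarrow> 2 * \<mu>"
    by real_asymp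
  note halves = near_limit_instance[OF this _ mf_lower_bound_halves[OF assms]]
  have "(\<lambda>n. real n * real CARD('d) * (1 - 1 / (real n + 1) + \<mu>) / (real n + 1 + \<mu>))
      \<longlonglongrightarrow> (\<mu> + 1) * real CARD('d)"
    by (real_asymp simp: algebra_simps)
  note dimension = near_limit_instance[OF this _ mf_lower_bound_dimension[OF assms]]
  \<comment> \<open>For each \<open>\<delta>\<close> the family belonging to the larger of the two
    bounds supplies the instance; this one statement yields both conjuncts.\<close>
  have "\<exists>R\<in>instances \<mu>. cost (move_to_front :: 'd algorithm) R \<ge>
      (max (2 * \<mu>) ((\<mu> + 1) * real CARD('d)) - \<delta>) * OPT R" if "\<delta> > 0" for \<delta>
    using halves[OF that] dimension[OF that]
    by (cases "2 * \<mu> \<le> (\<mu> + 1) * real CARD('d)") (auto simp only: max.absorb1 max.absorb2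
        linear not_le less_imp_le)
  then show ?thesis
    by (intro conjI competitive_ratio_geI) blast+
qed

end
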